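(* Let $G$ be a finite simple graph that is weakly claw-free. Then $\gamma_{Zg}(G)=\gamma_g(G)$ and $\gamma_{Zg}'(G)=\gamma_g'(G)$.
   Context: Graphs are finite and simple. $N(v)$ and $N[v]=N(v)\cup\{v\}$ denote the open and closed neighborhood of a vertex $v$. A vertex $w$ is the center of a claw if $w$ has three pairwise non-adjacent neighbors (i.e. $w$ is the degree-$3$ vertex of an induced $K_{1,3}$). A graph $G$ is weakly claw-free if every vertex $u\in V(G)$ has a neighbor that is not the center of a claw (in particular, $G$ has no isolated vertices). Games: two players, Dominator and Staller, alternately select vertices $v_1,v_2,\ldots$ of an isolate-free graph $G$. In the domination game the $i$-th move $v_i$ is legal if $N[v_i]\setminus\bigcup_{j=1}^{i-1}N[v_j]\neq\emptyset$. In the Z-domination game the $i$-th move $v_i$ is legal if $N(v_i)\setminus\bigcup_{j=1}^{i-1}N[v_j]\neq\emptyset$. Each game ends when no legal move is available. Dominator wants to minimize the total number of moves, Staller wants to maximize it. When both players play optimally, the total number of moves played (by both players) is, in the domination game, $\gamma_g(G)$ if Dominator moves first and $\gamma_g'(G)$ if Staller moves first; and in the Z-domination game, $\gamma_{Zg}(G)$ if Dominator moves first and $\gamma_{Zg}'(G)$ if Staller moves first. *)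

theory Defs
  imports "Graph_Theory.Pair_Digraph"
begin

datatype player = Dominator | Staller

datatype game = Domination | Z_Domination

text \<open>
  The locale \<^locale>\<open>pair_graph\<close> consists of the finite simple graphs: an undirected edge
  between u and v is represented by the two arcs (u, v) and (v, u).
\<close>

context pair_graph
begin

definition open_nbhd :: "'a \<Rightarrow> 'a set" where
  "open_nbhd v = {u. v \<rightarrow>\<^bsub>G\<^esub> u}"

definition closed_nbhd :: "'a \<Rightarrow> 'a set" where
  "closed_nbhd v = insert v (open_nbhd v)"

definition claw_center :: "'a \<Rightarrow> bool" where
  "claw_center w \<longleftrightarrow>
     (\<exists>X \<subseteq> open_nbhd w. card X = 3 \<and> pairwise (\<lambda>x y. \<not> x \<rightarrow>\<^bsub>G\<^esub> y) X)"

definition weakly_claw_free :: bool where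
  "weakly_claw_free \<longleftrightarrow> (\<forall>u \<in> pverts G. \<exists>w \<in> open_nbhd u. \<not> claw_center w)"

fun legality_nbhd :: "game \<Rightarrow> 'a \<Rightarrow> 'a set" where
  "legality_nbhd Domination v = closed_nbhd v"
| "legality_nbhd Z_Domination v = open_nbhd v"

text \<open>A position is the list of the vertices selected so far.\<close>

definition legal_moves :: "game \<Rightarrow> 'a list \<Rightarrow> 'a set" where
  "legal_moves g h =
     {v \<in> pverts G. legality_nbhd g v - (\<Union>x \<in> set h. closed_nbhd x) \<noteq> {}}"

lemma finite_legal_moves: "finite (legal_moves g h)"
  unfolding legal_moves_def by simp

lemma closed_nbhd_subset: "v \<in> pverts G \<Longrightarrow> closed_nbhd v \<subseteq> pverts G"
  unfolding closed_nbhd_def open_nbhd_def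
  by (auto dest: in_arcsD2 simp: arcs_ends_conv)

lemma legality_nbhd_subset: "legality_nbhd g v \<subseteq> closed_nbhd v"
  by (cases g) (auto simp: closed_nbhd_def)

text \<open>
  The number of moves still to be played from position h, with the given player to move,
  when both players play optimally.
\<close>

function moves_left :: "game \<Rightarrow> player \<Rightarrow> 'a list \<Rightarrow> nat" where
  "moves_left g Dominator h =
     (if legal_moves g h = {} then 0
      else Suc (MIN v \<in> legal_moves g h. moves_left g Staller (h @ [v])))"
| "moves_left g Staller h =
     (if legal_moves g h = {} then 0
      else Suc (MAX v \<in> legal_moves g h. moves_left g Dominator (h @ [v])))"
  by pat_completeness auto

lemma undominated_decreases:
  assumes "v \<in> legal_moves g h"
  shows "card (pverts G - (\<Union>x \<in> set (h @ [v]). closed_nbhd x))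
       < card (pverts G - (\<Union>x \<in> set h. closed_nbhd x))"
proof (rule psubset_card_mono)
  obtain u where u: "u \<in> legality_nbhd g v" "u \<notin> (\<Union>x \<in> set h. closed_nbhd x)"
    and v: "v \<in> pverts G"
    using assms unfolding legal_moves_def by blast
  then have "u \<in> closed_nbhd v" "u \<in> pverts G"
    using legality_nbhd_subset closed_nbhd_subset by blast+
  with u show "pverts G - (\<Union>x \<in> set (h @ [v]). closed_nbhd x)
      \<subset> pverts G - (\<Union>x \<in> set h. closed_nbhd x)"
    by auto
qed simp

termination
  by (relation "measure (\<lambda>(g, p, h). card (pverts G - (\<Union>x \<in> set h. closed_nbhd x)))")
    (use undominated_decreases in simp_all)

declare moves_left.simps [simp del]

definition gamma_g :: nat where
  "gamma_g = moves_left Domination Dominator []"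

definition gamma_g' :: nat where
  "gamma_g' = moves_left Domination Staller []"

definition gamma_Zg :: nat where
  "gamma_Zg = moves_left Z_Domination Dominator []"

definition gamma_Zg' :: nat where
  "gamma_Zg' = moves_left Z_Domination Staller []"

end

end

theory Submission
  imports Defs
begin

text \<open>
  The two games have the same positions up to the set of dominated vertices. A move v that is
  legal only in the domination game is an undominated vertex all of whose neighbours are dominated.
  Let w be a neighbour of v that is not a claw center, and let s be a selected vertex dominating w;
  s differs from w because v is undominated. If w had an undominated neighbour c other than v, then
  s, v, c would be pairwise non-adjacent neighbours of w, as all of N[s] and N(v) is dominated.
  Hence selecting w, which is legal in the Z-domination game, has the same effect as selecting v.
\<close>

context pair_graph
begin

abbreviation dominated :: "'a list \<Rightarrow> 'a set" where
  "dominated h \<equiv> (\<Union>x \<in> set h. closed_nbhd x)"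

lemma mem_open_nbhd_sym: "u \<in> open_nbhd v \<longleftrightarrow> v \<in> open_nbhd u"
  unfolding open_nbhd_def by (auto intro: arcs_symmetric)

lemma open_nbhd_subset: "open_nbhd v \<subseteq> pverts G"
  unfolding open_nbhd_def by (auto dest: in_arcsD2 simp: arcs_ends_conv)

lemma claw_centerI:
  assumes "x \<in> open_nbhd w" "y \<in> open_nbhd w" "z \<in> open_nbhd w"
    and "x \<noteq> y" "x \<noteq> z" "y \<noteq> z"
    and "y \<notin> open_nbhd x" "z \<notin> open_nbhd x" "z \<notin> open_nbhd y"
  shows "claw_center w"
proof -
  have "pairwise (\<lambda>x y. y \<notin> open_nbhd x) {x, y, z}"
    using assms mem_open_nbhd_sym by (auto simp: pairwise_insert)
  then have "pairwise (\<lambda>x y. \<not> x \<rightarrow>\<^bsub>G\<^esub> y) {x, y, z}"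
    by (simp add: open_nbhd_def)
  then show ?thesis
    unfolding claw_center_def using assms by (intro exI[of _ "{x, y, z}"]) auto
qed

lemma Z_move_equivalent:
  assumes wcf: "weakly_claw_free"
    and v: "v \<in> legal_moves Domination h"
  obtains w where "w \<in> legal_moves Z_Domination h"
    and "closed_nbhd w \<union> dominated h = closed_nbhd v \<union> dominated h"
proof (cases "v \<in> legal_moves Z_Domination h")
  case True
  then show ?thesis using that by blast
next
  case False
  from v have "v \<in> pverts G" by (simp add: legal_moves_def)
  with False have N: "open_nbhd v \<subseteq> dominated h" by (auto simp: legal_moves_def)
  \<comment> \<open>Legality yields an undominated vertex of \<open>closed_nbhd v\<close>; no
    neighbour of \<open>v\<close> qualifies, so it is \<open>v\<close> itself.\<close>
  with v have vU: "v \<notin> dominated h" by (auto simp: legal_moves_def closed_nbhd_def)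
  obtain w where w: "w \<in> open_nbhd v" "\<not> claw_center w"
    using wcf \<open>v \<in> pverts G\<close> unfolding weakly_claw_free_def by blast
  then have vw: "v \<in> open_nbhd w" using mem_open_nbhd_sym by blast
  from w N obtain s where s: "s \<in> set h" "w \<in> closed_nbhd s" by blast
  have "s \<noteq> w" using vU vw s(1) by (auto simp: closed_nbhd_def)
  with s(2) have sw: "s \<in> open_nbhd w"
    using mem_open_nbhd_sym by (auto simp: closed_nbhd_def)
  have "c \<in> dominated h" if c: "c \<in> open_nbhd w" "c \<noteq> v" for c
  proof (rule ccontr)
    assume cU: "c \<notin> dominated h"
    have "claw_center w"
    proof (rule claw_centerI[of s w v c])
      show "c \<notin> open_nbhd v" using N cU by blast
    qed (use sw vw c s(1) cU vU in \<open>auto simp: closed_nbhd_def\<close>)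
    with w show False by blast
  qed
  \<comment> \<open>\<open>w\<close> is already dominated, so selecting either \<open>w\<close> or
    \<open>v\<close> newly dominates \<open>v\<close> alone.\<close>
  then have "closed_nbhd w \<union> dominated h = closed_nbhd v \<union> dominated h"
    using w N vw unfolding closed_nbhd_def by blast
  moreover have "w \<in> legal_moves Z_Domination h"
    using w vw vU open_nbhd_subset by (auto simp: legal_moves_def)
  ultimately show ?thesis using that by blast
qed

text \<open>Legality depends on the history only through the dominated set, and every move legal in
  either game is legal in the domination game. Keeping \<open>g\<close> and \<open>g'\<close>
  arbitrary lets moves be matched in both directions.\<close>

lemma move_equivalent:
  assumes "weakly_claw_free"
    and eq: "dominated h = dominated h'"
    and v: "v \<in> legal_moves g h"
  obtains w where "w \<in> legal_moves g' h'" and "dominated (h @ [v]) = dominated (h' @ [w])"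
proof -
  have legal_eq: "legal_moves k h = legal_moves k h'" for k
    unfolding legal_moves_def eq ..
  have dom: "v \<in> legal_moves Domination h"
    using v legality_nbhd_subset[of g v] by (auto simp: legal_moves_def)
  have "\<exists>w \<in> legal_moves g' h. closed_nbhd w \<union> dominated h = closed_nbhd v \<union> dominated h"
  proof (cases g')
    case Domination
    then show ?thesis using dom by blast
  next
    case Z_Domination
    then show ?thesis using Z_move_equivalent[OF assms(1) dom] by metis
  qed
  then show ?thesis using that legal_eq eq by auto
qed

text \<open>Matched moves may select different vertices, so the induction has to compare histories
  that agree only in what they dominate.\<close>

lemma moves_left_eq:
  assumes wcf: "weakly_claw_free"
    and "dominated h = dominated h'"
  shows "moves_left g p h = moves_left g' p h'"
  using assms(2)
proof (induction "card (pverts G - dominated h)" arbitrary: g g' p h h' rule: less_induct)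
  case less
  have IH: "moves_left g q (h @ [v]) = moves_left g' q (h' @ [w])"
    if "v \<in> legal_moves g h" "dominated (h @ [v]) = dominated (h' @ [w])" for q v w
    using less.hyps[OF undominated_decreases that(2)] that(1) by blast
  \<comment> \<open>Equality of the whole sets of values gives equal minima and equal maxima, so it
    serves both players; it also shows that the games end together.\<close>
  have values_eq: "(\<lambda>v. moves_left g q (h @ [v])) ` legal_moves g h =
      (\<lambda>w. moves_left g' q (h' @ [w])) ` legal_moves g' h'" (is "?A = ?B") for q
  proof
    show "?A \<subseteq> ?B"
    proof (rule image_subsetI)
      fix v assume v: "v \<in> legal_moves g h"
      then obtain w where "w \<in> legal_moves g' h'" "dominated (h @ [v]) = dominated (h' @ [w])"
        using move_equivalent[OF wcf less.prems] by metis
      with IH[OF v] show "moves_left g q (h @ [v]) \<in> ?B" by (metis image_eqI)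
    qed
    show "?B \<subseteq> ?A"
    proof (rule image_subsetI)
      fix w assume "w \<in> legal_moves g' h'"
      then obtain v where v: "v \<in> legal_moves g h" "dominated (h' @ [w]) = dominated (h @ [v])"
        using move_equivalent[OF wcf less.prems[symmetric]] by metis
      with IH[OF v(1) v(2)[symmetric]] show "moves_left g' q (h' @ [w]) \<in> ?A" by (metis image_eqI)
    qed
  qed
  then have "legal_moves g h = {} \<longleftrightarrow> legal_moves g' h' = {}"
    by (metis image_is_empty)
  with values_eq show ?case
    by (cases p) (simp_all only: moves_left.simps[of g h] moves_left.simps[of g' h'])
qed

end

theorem theorem4p2:
  fixes G :: "'a pair_pre_digraph"
  assumes "pair_graph G"
    and "pair_graph.weakly_claw_free G"
  shows "pair_graph.gamma_Zg G = pair_graph.gamma_g G \<and>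
         pair_graph.gamma_Zg' G = pair_graph.gamma_g' G"
proof -
  interpret pair_graph G by fact
  show ?thesis
    unfolding gamma_Zg_def gamma_g_def gamma_Zg'_def gamma_g'_def
    using moves_left_eq[OF assms(2) refl] by blast
qed

end
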